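(* Let $S_a$ be a binary univariate linear subdivision scheme with finitely supported real mask $\mathbf{a}=\{a_i\}_{i\in\mathbb{Z}}$ satisfying $$\sum_j a_{2j}=\sum_j a_{2j+1}=1,$$ let $a(z)=\sum_i a_i z^i$, and let $q(z)=\frac{a(z)}{1+z}=\sum_i q_i z^i$. Put $S_e=\sum_j q_{2j}$ and $S_o=\sum_j q_{2j+1}$. If the coefficients of $q(z)$ are non-negative, then $S_a$ is convergent, with contractivity factor $\mu=\max\{S_e,S_o\}<1$.
   Context: The scheme $S_a$ acts on bounded real sequences $f=\{f_i\}_{i\in\mathbb{Z}}$ by $(S_a f)_i=\sum_{j\in\mathbb{Z}} a_{i-2j} f_j$. Norms of sequences are supremum norms over $\mathbb{Z}$, and $(\Delta f)_i=f_{i+1}-f_i$. The condition on the mask is equivalent to $a(1)=2$, $a(-1)=0$, so $q(z)$ is a Laurent polynomial with $q(1)=1$. Given bounded initial data $f^0$, put $f^{k+1}=S_a f^k$ and let $\mathbf{f}^k:\mathbb{R}\to\mathbb{R}$ be the continuous piecewise linear function with $\mathbf{f}^k(2^{-k}i)=f^k_i$ for $i\in\mathbb{Z}$, linear on each interval $(i2^{-k},(i+1)2^{-k})$. The scheme $S_a$ is convergent if for every bounded initial data $f^0$ the sequence $\{\mathbf{f}^k\}_{k\ge0}$ converges uniformly (the limit, necessarily continuous, is denoted $S_a^\infty f^0$), and there exists $f^0$ with $S_a^\infty f^0\not\equiv0$. A number $\mu\in(0,1)$ is a contractivity factor of $S_a$ if there exists $L\in\mathbb{N}=\{1,2,\dots\}$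 (called the contractivity number) such that $\|\Delta S_a^L f\|\le\mu\|\Delta f\|$ for all bounded sequences $f$, where $S_a^L$ is the $L$-fold composition of $S_a$.
   Formalization: The inequality max{S_e,S_o} < 1 is assumed rather than concluded; it does not follow from non-negativity of q: for a(z) = 1+z we have q = 1, S_e = 1, S_o = 0, and the scheme is not convergent. *)

theory Defs
  imports
    "HOL-Analysis.Analysis"
    "HOL-Computational_Algebra.Formal_Laurent_Series"
begin

text \<open>
  Masks are functions \<open>a :: int \<Rightarrow> real\<close>; finite support and boundedness of the data are explicit
  hypotheses. For a mask of finite support the unconditional sums below have only finitely many
  non-zero terms.
\<close>

definition subdivision :: "(int \<Rightarrow> real) \<Rightarrow> (int \<Rightarrow> real) \<Rightarrow> int \<Rightarrow> real" where
  "subdivision a f = (\<lambda>i. \<Sum>\<^sub>\<infinity>j\<in>UNIV. a (i - 2 * j) * f j)"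

definition difference :: "(int \<Rightarrow> real) \<Rightarrow> int \<Rightarrow> real" where
  "difference f = (\<lambda>i. f (i + 1) - f i)"

text \<open>Only meaningful for bounded sequences, to which all uses below are restricted.\<close>

definition sup_norm :: "(int \<Rightarrow> real) \<Rightarrow> real" where
  "sup_norm f = (SUP i. \<bar>f i\<bar>)"

text \<open>
  The continuous function on the real line with value \<open>f i\<close> at \<open>i / 2 ^ k\<close> that is affine between
  consecutive points of this grid.
\<close>

definition pl_interpolant :: "nat \<Rightarrow> (int \<Rightarrow> real) \<Rightarrow> real \<Rightarrow> real" where
  "pl_interpolant k f x =
     (let i = \<lfloor>2 ^ k * x\<rfloor>; t = frac (2 ^ k * x) in (1 - t) * f i + t * f (i + 1))"

definition subdivision_interpolant ::
  "(int \<Rightarrow> real) \<Rightarrow> (int \<Rightarrow> real) \<Rightarrow> nat \<Rightarrow> real \<Rightarrow> real" where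
  "subdivision_interpolant a f k = pl_interpolant k ((subdivision a ^^ k) f)"

text \<open>The pointwise limit, which is the uniform limit whenever the latter exists.\<close>

definition subdivision_limit :: "(int \<Rightarrow> real) \<Rightarrow> (int \<Rightarrow> real) \<Rightarrow> real \<Rightarrow> real" where
  "subdivision_limit a f x = lim (\<lambda>k. subdivision_interpolant a f k x)"

definition convergent_subdivision :: "(int \<Rightarrow> real) \<Rightarrow> bool" where
  "convergent_subdivision a \<longleftrightarrow>
     (\<forall>f. bounded (range f) \<longrightarrow> uniformly_convergent_on UNIV (subdivision_interpolant a f)) \<and>
     (\<exists>f. bounded (range f) \<and> (\<exists>x. subdivision_limit a f x \<noteq> 0))"

definition contractivity_factor :: "(int \<Rightarrow> real) \<Rightarrow> real \<Rightarrow> bool" where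
  "contractivity_factor a \<mu> \<longleftrightarrow> 0 < \<mu> \<and> \<mu> < 1 \<and>
     (\<exists>L\<ge>1. \<forall>f. bounded (range f) \<longrightarrow>
        sup_norm (difference ((subdivision a ^^ L) f)) \<le> \<mu> * sup_norm (difference f))"

definition symbol :: "(int \<Rightarrow> real) \<Rightarrow> real fls" where
  "symbol a = (\<Sum>i | a i \<noteq> 0. fls_const (a i) * fls_X_intpow i)"

text \<open>
  The quotient is taken in the field of formal Laurent series. When \<open>1 + z\<close> divides the symbol, that
  is when \<open>a(-1) = 0\<close>, it is the Laurent polynomial \<open>q(z)\<close> with \<open>a(z) = (1 + z) q(z)\<close>.
\<close>

definition quotient_symbol :: "(int \<Rightarrow> real) \<Rightarrow> real fls" where
  "quotient_symbol a = symbol a / (1 + fls_X)"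

end

theory Submission
  imports Defs
begin

text \<open>
  Since \<open>a(z) = (1 + z) q(z)\<close>, the differences of refined data are again produced by a subdivision
  rule, whose mask is \<open>q\<close>: up to a shift, \<open>\<Delta> S\<^sub>a f = S\<^sub>q \<Delta> f\<close> (lemma \<open>difference_subdivision\<close>).
  Non-negativity makes the weights of \<open>S\<^sub>q\<close> at each point add up, in absolute value, to \<open>S\<^sub>e\<close> or
  \<open>S\<^sub>o\<close> according to parity, so one step of \<open>S\<^sub>a\<close> already contracts differences by
  \<open>\<mu> = max S\<^sub>e S\<^sub>o\<close>. Adding up the even coefficients in \<open>a(z) = (1 + z) q(z)\<close>, whose
  sum is 1, gives \<open>S\<^sub>e + S\<^sub>o = 1\<close>, whence \<open>\<mu> > 0\<close>.

  Convergence follows from contraction. Because the weights of \<open>S\<^sub>a\<close> at each point add up to 1 and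
  sit at bounded distance, a refined value differs from the coarse value at the same place by at most
  a constant times the largest coarse difference (lemma \<open>subdivision_close_to_parent\<close>).
  Consecutive interpolants are therefore uniformly within a constant times \<open>\<mu>\<^sup>k\<close> of each other, and
  the Weierstrass M-test applies. The limit does not always vanish, as constants are reproduced.
\<close>

section \<open>Weights of a subdivision rule\<close>

lemma finite_support_weights:
  fixes c :: "int \<Rightarrow> real"
  assumes "finite {i. c i \<noteq> 0}"
  shows "finite {j. c (i - 2 * j) \<noteq> 0}"
proof -
  have "{j. c (i - 2 * j) \<noteq> 0} = (\<lambda>j. i - 2 * j) -` {i. c i \<noteq> 0}"
    by auto
  moreover have "inj (\<lambda>j. i - 2 * j)"
    by (auto intro: injI)
  ultimately show ?thesis
    using finite_vimageI[OF assms] by metis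
qed

lemma summable_weights:
  fixes c :: "int \<Rightarrow> real"
  assumes "finite {i. c i \<noteq> 0}"
  shows "(\<lambda>j. c (i - 2 * j) * g j) summable_on UNIV"
proof (rule finite_nonzero_values_imp_summable_on)
  have "{j \<in> UNIV. c (i - 2 * j) * g j \<noteq> 0} \<subseteq> {j. c (i - 2 * j) \<noteq> 0}"
    by auto
  then show "finite {j \<in> UNIV. c (i - 2 * j) * g j \<noteq> 0}"
    by (rule finite_subset) (rule finite_support_weights[OF assms])
qed

lemma infsum_weights_diff:
  fixes c :: "int \<Rightarrow> real"
  assumes fin: "finite {i. c i \<noteq> 0}"
  shows "(\<Sum>\<^sub>\<infinity>j\<in>UNIV. c (i - 2 * j) * g j) - (\<Sum>\<^sub>\<infinity>j\<in>UNIV. c (i - 2 * j) * h j) =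
    (\<Sum>\<^sub>\<infinity>j\<in>UNIV. c (i - 2 * j) * (g j - h j))"
  using infsum_add[OF summable_weights[OF fin, of i "\<lambda>j. g j - h j"] summable_weights[OF fin, of i h]]
  by (simp add: algebra_simps)

text \<open>
  The weights used at position \<open>i\<close> are exactly the mask coefficients whose index has the parity of
  \<open>i\<close>, traversed by \<open>j \<mapsto> i div 2 - j\<close>.
\<close>

lemma sum_weights_parity:
  fixes c :: "int \<Rightarrow> real"
  shows "(\<Sum>\<^sub>\<infinity>j\<in>UNIV. c (i - 2 * j)) =
    (if even i then (\<Sum>\<^sub>\<infinity>j\<in>UNIV. c (2 * j)) else (\<Sum>\<^sub>\<infinity>j\<in>UNIV. c (2 * j + 1)))"
proof -
  have bij: "bij_betw (\<lambda>j. i div 2 - j) UNIV UNIV"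
    by (rule bij_betwI[where g = "\<lambda>j. i div 2 - j"]) auto
  have "(\<Sum>\<^sub>\<infinity>j\<in>UNIV. c (i - 2 * j)) = (\<Sum>\<^sub>\<infinity>j\<in>UNIV. c (2 * (i div 2 - j) + i mod 2))"
    by (rule infsum_cong, rule arg_cong[where f = c]) presburger
  also have "\<dots> = (\<Sum>\<^sub>\<infinity>j\<in>UNIV. c (2 * j + i mod 2))"
    by (rule infsum_reindex_bij_betw[OF bij])
  finally show ?thesis
    by (auto simp: odd_iff_mod_2_eq_one even_iff_mod_2_eq_zero)
qed

lemma abs_weighted_sum_le:
  fixes c g h :: "int \<Rightarrow> real"
  assumes fin: "finite {i. c i \<noteq> 0}"
    and le: "\<And>j. \<bar>g j\<bar> \<le> h (i - 2 * j) * D"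
  shows "\<bar>\<Sum>\<^sub>\<infinity>j\<in>UNIV. c (i - 2 * j) * g j\<bar> \<le> (\<Sum>\<^sub>\<infinity>j\<in>UNIV. \<bar>c (i - 2 * j)\<bar> * h (i - 2 * j)) * D"
proof -
  have fin': "finite {i. \<bar>c i\<bar> \<noteq> 0}"
    using fin by simp
  have abs: "(\<lambda>j. norm (c (i - 2 * j) * g j)) summable_on UNIV"
    using summable_weights[OF fin', of i "\<lambda>j. \<bar>g j\<bar>"] by (simp add: abs_mult)
  have "\<bar>\<Sum>\<^sub>\<infinity>j\<in>UNIV. c (i - 2 * j) * g j\<bar> \<le> (\<Sum>\<^sub>\<infinity>j\<in>UNIV. norm (c (i - 2 * j) * g j))"
    using norm_infsum_bound[OF abs] by simp
  also have "\<dots> \<le> (\<Sum>\<^sub>\<infinity>j\<in>UNIV. \<bar>c (i - 2 * j)\<bar> * (h (i - 2 * j) * D))"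
    by (rule infsum_mono[OF abs summable_weights[OF fin']])
      (simp add: abs_mult le mult_left_mono)
  also have "\<dots> = (\<Sum>\<^sub>\<infinity>j\<in>UNIV. (\<bar>c (i - 2 * j)\<bar> * h (i - 2 * j)) * D)"
    by (simp add: mult.assoc)
  also have "\<dots> = (\<Sum>\<^sub>\<infinity>j\<in>UNIV. \<bar>c (i - 2 * j)\<bar> * h (i - 2 * j)) * D"
    by (rule infsum_cmult_left) (rule summable_weights[OF fin'])
  finally show ?thesis .
qed

section \<open>The quotient mask\<close>

lemma fls_nth_sum: "fls_nth (\<Sum>i\<in>A. f i) n = (\<Sum>i\<in>A. fls_nth (f i) n)"
  by (induction A rule: infinite_finite_induct) auto

lemma symbol_nth:
  assumes "finite {i. a i \<noteq> 0}"
  shows "fls_nth (symbol a) n = a n"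
proof -
  have "fls_nth (symbol a) n = (\<Sum>i | a i \<noteq> 0. if i = n then a i else 0)"
    unfolding symbol_def fls_nth_sum
    by (rule sum.cong) (auto simp: fls_X_intpow_times_conv_shift)
  then show ?thesis
    using assms by simp
qed

lemma mask_eq_quotient_sum:
  assumes "finite {i. a i \<noteq> 0}"
  shows "a n = fls_nth (quotient_symbol a) n + fls_nth (quotient_symbol a) (n - 1)"
proof -
  have "fls_nth (1 + fls_X :: real fls) 0 \<noteq> 0"
    by simp
  then have "(1 + fls_X :: real fls) \<noteq> 0"
    by (metis fls_zero_nth)
  then have "symbol a = (1 + fls_X) * quotient_symbol a"
    by (simp add: quotient_symbol_def)
  then have "a n = fls_nth ((1 + fls_X) * quotient_symbol a) n"
    using symbol_nth[OF assms] by metis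
  then show ?thesis
    by (simp add: distrib_right fls_X_times_conv_shift)
qed

section \<open>Contraction of differences\<close>

text \<open>
  Factoring out \<open>1 + z\<close> turns the difference of \<open>a\<close>-weights into a telescoping difference
  \<open>q (i + 1 - 2 * j) - q (i + 1 - 2 * (j + 1))\<close>, and summation by parts moves it onto the data.
\<close>

lemma difference_subdivision:
  assumes fin: "finite {i. q i \<noteq> 0}"
    and aq: "\<And>i. a i = q i + q (i - 1)"
  shows "difference (subdivision a f) i = (\<Sum>\<^sub>\<infinity>j\<in>UNIV. q (i + 1 - 2 * j) * difference f (j - 1))"
proof -
  note sm = summable_weights[OF fin]
  have split: "subdivision a f n =
      (\<Sum>\<^sub>\<infinity>j\<in>UNIV. q (n - 2 * j) * f j) + (\<Sum>\<^sub>\<infinity>j\<in>UNIV. q (n - 1 - 2 * j) * f j)" for n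
    unfolding subdivision_def infsum_add[OF sm sm, symmetric]
    by (simp add: aq algebra_simps)
  have "bij_betw (\<lambda>j. j - 1) (UNIV :: int set) UNIV"
    by (rule bij_betwI[where g = "\<lambda>j. j + 1"]) auto
  from infsum_reindex_bij_betw[OF this, of "\<lambda>j. q (i - 1 - 2 * j) * f j"]
  have shift: "(\<Sum>\<^sub>\<infinity>j\<in>UNIV. q (i - 1 - 2 * j) * f j) = (\<Sum>\<^sub>\<infinity>j\<in>UNIV. q (i + 1 - 2 * j) * f (j - 1))"
    by (simp add: algebra_simps)
  have "difference (subdivision a f) i =
      (\<Sum>\<^sub>\<infinity>j\<in>UNIV. q (i + 1 - 2 * j) * f j) - (\<Sum>\<^sub>\<infinity>j\<in>UNIV. q (i - 1 - 2 * j) * f j)"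
    by (simp add: difference_def split)
  also have "\<dots> = (\<Sum>\<^sub>\<infinity>j\<in>UNIV. q (i + 1 - 2 * j) * (f j - f (j - 1)))"
    unfolding shift by (rule infsum_weights_diff[OF fin])
  finally show ?thesis
    by (simp add: difference_def)
qed

lemma difference_subdivision_le:
  assumes fin: "finite {i. q i \<noteq> 0}"
    and aq: "\<And>i. a i = q i + q (i - 1)"
    and nonneg: "\<And>i. q i \<ge> 0"
    and D: "\<And>i. \<bar>difference f i\<bar> \<le> D"
  shows "\<bar>difference (subdivision a f) i\<bar> \<le>
    max (\<Sum>\<^sub>\<infinity>j\<in>UNIV. q (2 * j)) (\<Sum>\<^sub>\<infinity>j\<in>UNIV. q (2 * j + 1)) * D"
proof -
  have "0 \<le> D"
    using D[of 0] by linarith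
  have "\<bar>difference (subdivision a f) i\<bar> \<le> (\<Sum>\<^sub>\<infinity>j\<in>UNIV. \<bar>q (i + 1 - 2 * j)\<bar> * 1) * D"
    unfolding difference_subdivision[OF fin aq]
    by (rule abs_weighted_sum_le[OF fin, where h = "\<lambda>_. 1"]) (simp add: D)
  also have "\<dots> = (\<Sum>\<^sub>\<infinity>j\<in>UNIV. q (i + 1 - 2 * j)) * D"
    using nonneg by simp
  also have "\<dots> \<le> max (\<Sum>\<^sub>\<infinity>j\<in>UNIV. q (2 * j)) (\<Sum>\<^sub>\<infinity>j\<in>UNIV. q (2 * j + 1)) * D"
    unfolding sum_weights_parity[of q]
    by (rule mult_right_mono[OF _ \<open>0 \<le> D\<close>]) simp
  finally show ?thesis .
qed

lemma quotient_parity_sums: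
  fixes a q :: "int \<Rightarrow> real"
  assumes fin: "finite {i. q i \<noteq> 0}"
    and aq: "\<And>i. a i = q i + q (i - 1)"
    and even_sum: "(\<Sum>\<^sub>\<infinity>j\<in>UNIV. a (2 * j)) = 1"
  shows "(\<Sum>\<^sub>\<infinity>j\<in>UNIV. q (2 * j)) + (\<Sum>\<^sub>\<infinity>j\<in>UNIV. q (2 * j + 1)) = 1"
proof -
  have sm: "(\<lambda>j. q (i - 2 * j)) summable_on UNIV" for i
    using summable_weights[OF fin, of i "\<lambda>_. 1"] by simp
  have "1 = (\<Sum>\<^sub>\<infinity>j\<in>UNIV. a (0 - 2 * j))"
    using even_sum sum_weights_parity[of a 0] by simp
  also have "\<dots> = (\<Sum>\<^sub>\<infinity>j\<in>UNIV. q (0 - 2 * j) + q (-1 - 2 * j))"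
    by (simp add: aq minus_diff_commute)
  also have "\<dots> = (\<Sum>\<^sub>\<infinity>j\<in>UNIV. q (0 - 2 * j)) + (\<Sum>\<^sub>\<infinity>j\<in>UNIV. q (-1 - 2 * j))"
    by (rule infsum_add[OF sm sm])
  finally show ?thesis
    unfolding sum_weights_parity[of q] by simp
qed

lemma abs_le_sup_norm:
  assumes "bounded (range f)"
  shows "\<bar>f i\<bar> \<le> sup_norm f"
proof -
  obtain B where "\<And>j. \<bar>f j\<bar> \<le> B"
    using assms by (auto simp: bounded_iff)
  then have "bdd_above (range (\<lambda>j. \<bar>f j\<bar>))"
    by (intro bdd_aboveI2)
  then show ?thesis
    unfolding sup_norm_def by (rule cSUP_upper2) auto
qed

lemma bounded_difference:
  assumes "bounded (range f)"
  shows "bounded (range (difference f))"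
proof -
  obtain B where "\<And>j. \<bar>f j\<bar> \<le> B"
    using assms by (auto simp: bounded_iff)
  then have "\<bar>difference f i\<bar> \<le> 2 * B" for i
    unfolding difference_def by (metis (no_types) abs_triangle_ineq4 add_mono mult_2 order_trans)
  then show ?thesis
    by (auto simp: bounded_iff)
qed

lemma contractivity_factorI:
  assumes "0 < \<mu>" "\<mu> < 1"
    and contr: "\<And>f D i. (\<And>i. \<bar>difference f i\<bar> \<le> D) \<Longrightarrow> \<bar>difference (subdivision a f) i\<bar> \<le> \<mu> * D"
  shows "contractivity_factor a \<mu>"
proof -
  have "sup_norm (difference (subdivision a f)) \<le> \<mu> * sup_norm (difference f)"
    if "bounded (range f)" for f
    unfolding sup_norm_def[of "difference (subdivision a f)"]
    by (rule cSUP_least) (auto intro!: contr abs_le_sup_norm bounded_difference that)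
  then show ?thesis
    using assms(1,2) unfolding contractivity_factor_def by (intro conjI exI[of _ 1]) simp_all
qed

section \<open>Convergence of contractive schemes\<close>

lemma abs_diff_le_of_difference:
  assumes D: "\<And>i. \<bar>difference f i\<bar> \<le> D"
  shows "\<bar>f j - f i\<bar> \<le> \<bar>j - i\<bar> * D"
proof -
  have step: "\<bar>f (m + int n) - f m\<bar> \<le> n * D" for m n
  proof (induction n)
    case (Suc n)
    have "\<bar>f (m + int n + 1) - f (m + int n)\<bar> \<le> D"
      using D[of "m + int n"] by (simp add: difference_def)
    with Suc have "\<bar>f (m + int n + 1) - f m\<bar> \<le> n * D + D"
      by linarith
    then show ?case
      by (simp add: algebra_simps)
  qed simp
  show ?thesis
  proof (cases "i \<le> j")
    case True
    then show ?thesis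
      using step[of i "nat (j - i)"] by simp
  next
    case False
    then show ?thesis
      using step[of j "nat (i - j)"] by (simp add: abs_minus_commute)
  qed
qed

lemma subdivision_one:
  assumes "(\<Sum>\<^sub>\<infinity>j\<in>UNIV. a (2 * j)) = 1" "(\<Sum>\<^sub>\<infinity>j\<in>UNIV. a (2 * j + 1)) = 1"
  shows "subdivision a (\<lambda>_. 1) = (\<lambda>_. 1)"
  using assms by (auto simp: subdivision_def sum_weights_parity)

text \<open>
  The weights add up to 1, so the left-hand side is an average of differences \<open>f j - f (i div 2)\<close>;
  each of these is controlled by the distance of \<open>j\<close> to \<open>i div 2\<close>, which is at most
  \<open>\<bar>i - 2 * j\<bar> + 1\<close>. Weighting the mask by that factor gives a constant independent of \<open>i\<close>.
\<close>

lemma subdivision_close_to_parent: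
  assumes fin: "finite {i. a i \<noteq> 0}"
    and sums: "(\<Sum>\<^sub>\<infinity>j\<in>UNIV. a (2 * j)) = 1" "(\<Sum>\<^sub>\<infinity>j\<in>UNIV. a (2 * j + 1)) = 1"
  obtains C where "C \<ge> 0"
    and "\<And>f D i. (\<And>i. \<bar>difference f i\<bar> \<le> D) \<Longrightarrow> \<bar>subdivision a f i - f (i div 2)\<bar> \<le> C * D"
proof
  let ?w = "\<lambda>i. \<bar>a i\<bar> * (real_of_int \<bar>i\<bar> + 1)"
  let ?C = "max (\<Sum>\<^sub>\<infinity>j\<in>UNIV. ?w (2 * j)) (\<Sum>\<^sub>\<infinity>j\<in>UNIV. ?w (2 * j + 1))"
  have "0 \<le> (\<Sum>\<^sub>\<infinity>j\<in>UNIV. ?w (2 * j))"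
    by (rule infsum_nonneg) simp
  then show "?C \<ge> 0"
    by linarith
  fix f :: "int \<Rightarrow> real" and D i
  assume D: "\<And>i. \<bar>difference f i\<bar> \<le> D"
  have "0 \<le> D"
    using D[of 0] by linarith
  have "f (i div 2) = subdivision a (\<lambda>_. 1) i * f (i div 2)"
    by (simp add: subdivision_one[OF sums])
  also have "\<dots> = (\<Sum>\<^sub>\<infinity>j\<in>UNIV. a (i - 2 * j) * 1 * f (i div 2))"
    unfolding subdivision_def
    by (rule infsum_cmult_left[symmetric]) (rule summable_weights[OF fin])
  finally have "subdivision a f i - f (i div 2) =
      (\<Sum>\<^sub>\<infinity>j\<in>UNIV. a (i - 2 * j) * f j) - (\<Sum>\<^sub>\<infinity>j\<in>UNIV. a (i - 2 * j) * f (i div 2))"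
    by (simp add: subdivision_def)
  also have "\<dots> = (\<Sum>\<^sub>\<infinity>j\<in>UNIV. a (i - 2 * j) * (f j - f (i div 2)))"
    by (rule infsum_weights_diff[OF fin])
  also have "\<bar>\<dots>\<bar> \<le> (\<Sum>\<^sub>\<infinity>j\<in>UNIV. ?w (i - 2 * j)) * D"
  proof (rule abs_weighted_sum_le[OF fin, where h = "\<lambda>m. real_of_int \<bar>m\<bar> + 1"])
    fix j
    have "\<bar>j - i div 2\<bar> \<le> \<bar>i - 2 * j\<bar> + 1"
      by presburger
    then have "real_of_int \<bar>j - i div 2\<bar> * D \<le> real_of_int (\<bar>i - 2 * j\<bar> + 1) * D"
      by (intro mult_right_mono \<open>0 \<le> D\<close>) (simp only: of_int_le_iff)
    then show "\<bar>f j - f (i div 2)\<bar> \<le> (real_of_int \<bar>i - 2 * j\<bar> + 1) * D"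
      using abs_diff_le_of_difference[OF D, of j "i div 2"] by simp
  qed
  also have "\<dots> \<le> ?C * D"
    unfolding sum_weights_parity[of ?w]
    by (rule mult_right_mono[OF _ \<open>0 \<le> D\<close>]) simp
  finally show "\<bar>subdivision a f i - f (i div 2)\<bar> \<le> ?C * D" .
qed

lemma pl_interpolant_close_to_node:
  assumes D: "\<And>i. \<bar>difference f i\<bar> \<le> D"
  shows "\<bar>pl_interpolant k f x - f \<lfloor>2 ^ k * x\<rfloor>\<bar> \<le> D"
proof -
  let ?t = "frac (2 ^ k * x)"
  have "pl_interpolant k f x - f \<lfloor>2 ^ k * x\<rfloor> = ?t * difference f \<lfloor>2 ^ k * x\<rfloor>"
    by (simp add: pl_interpolant_def Let_def difference_def algebra_simps)
  moreover have "\<bar>?t\<bar> * \<bar>difference f \<lfloor>2 ^ k * x\<rfloor>\<bar> \<le> 1 * D"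
    using D frac_lt_1[of "2 ^ k * x"] by (intro mult_mono) auto
  ultimately show ?thesis
    by (simp add: abs_mult)
qed

lemma consecutive_interpolants_close:
  assumes D: "\<And>i. \<bar>difference f i\<bar> \<le> D"
    and E: "\<And>i. \<bar>difference g i\<bar> \<le> E"
    and B: "\<And>i. \<bar>g i - f (i div 2)\<bar> \<le> B"
  shows "\<bar>pl_interpolant (Suc k) g x - pl_interpolant k f x\<bar> \<le> E + B + D"
proof -
  have "\<lfloor>2 ^ Suc k * x\<rfloor> div 2 = \<lfloor>2 ^ k * x\<rfloor>"
    using floor_divide_real_eq_div[of 2 "2 ^ Suc k * x"] by simp
  then have "\<bar>g \<lfloor>2 ^ Suc k * x\<rfloor> - f \<lfloor>2 ^ k * x\<rfloor>\<bar> \<le> B"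
    using B by metis
  then show ?thesis
    using pl_interpolant_close_to_node[OF D, of k x] pl_interpolant_close_to_node[OF E, of "Suc k" x]
    by linarith
qed

lemma uniformly_convergent_geometric_increments:
  fixes F :: "nat \<Rightarrow> 'a \<Rightarrow> real"
  assumes "0 \<le> \<mu>" "\<mu> < 1"
    and le: "\<And>k x. \<bar>F (Suc k) x - F k x\<bar> \<le> K * \<mu> ^ k"
  shows "uniformly_convergent_on UNIV F"
proof -
  have "uniformly_convergent_on UNIV (\<lambda>n x. \<Sum>k<n. F (Suc k) x - F k x)"
    by (rule Weierstrass_m_test'[where M = "\<lambda>k. K * \<mu> ^ k"])
      (use assms in \<open>auto intro: summable_mult\<close>)
  then obtain l where "uniform_limit UNIV (\<lambda>n x. F n x - F 0 x) l sequentially"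
    by (simp only: uniformly_convergent_on_def sum_lessThan_telescope[where f = "\<lambda>k. F k x" for x]) blast
  then have "uniform_limit UNIV (\<lambda>n x. (F n x - F 0 x) + F 0 x) (\<lambda>x. l x + F 0 x) sequentially"
    by (intro uniform_limit_add uniform_limit_const)
  then show ?thesis
    by (auto simp: uniformly_convergent_on_def)
qed

lemma convergent_subdivision_if_contractive:
  assumes fin: "finite {i. a i \<noteq> 0}"
    and sums: "(\<Sum>\<^sub>\<infinity>j\<in>UNIV. a (2 * j)) = 1" "(\<Sum>\<^sub>\<infinity>j\<in>UNIV. a (2 * j + 1)) = 1"
    and mu: "0 \<le> \<mu>" "\<mu> < 1"
    and contr: "\<And>f D i. (\<And>i. \<bar>difference f i\<bar> \<le> D) \<Longrightarrow> \<bar>difference (subdivision a f) i\<bar> \<le> \<mu> * D"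
  shows "convergent_subdivision a"
proof -
  obtain C where C: "C \<ge> 0"
    "\<And>f D i. (\<And>i. \<bar>difference f i\<bar> \<le> D) \<Longrightarrow> \<bar>subdivision a f i - f (i div 2)\<bar> \<le> C * D"
    using subdivision_close_to_parent[OF fin sums] by metis
  have "uniformly_convergent_on UNIV (subdivision_interpolant a f)" if bdd: "bounded (range f)" for f
  proof -
    define D where "D = sup_norm (difference f)"
    let ?f = "\<lambda>k. (subdivision a ^^ k) f"
    have decay: "\<bar>difference (?f k) i\<bar> \<le> \<mu> ^ k * D" for k i
    proof (induction k arbitrary: i)
      case 0
      then show ?case
        using abs_le_sup_norm[OF bounded_difference[OF bdd]] by (simp add: D_def)
    next
      case (Suc k)
      then show ?case
        using contr[of "?f k" "\<mu> ^ k * D" i] by (simp add: mult.assoc)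
    qed
    have "\<bar>pl_interpolant (Suc k) (?f (Suc k)) x - pl_interpolant k (?f k) x\<bar> \<le>
        ((\<mu> + C + 1) * D) * \<mu> ^ k" for k x
    proof -
      have "\<bar>pl_interpolant (Suc k) (?f (Suc k)) x - pl_interpolant k (?f k) x\<bar> \<le>
          \<mu> ^ Suc k * D + C * (\<mu> ^ k * D) + \<mu> ^ k * D"
      proof (rule consecutive_interpolants_close[OF decay decay])
        show "\<bar>?f (Suc k) i - ?f k (i div 2)\<bar> \<le> C * (\<mu> ^ k * D)" for i
          using C(2)[OF decay, of k i] by simp
      qed
      then show ?thesis
        by (simp add: algebra_simps)
    qed
    then show ?thesis
      unfolding subdivision_interpolant_def
      by (rule uniformly_convergent_geometric_increments[OF mu])
  qed
  moreover have "subdivision_limit a (\<lambda>_. 1) x = 1" for x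
  proof -
    have "(subdivision a ^^ k) (\<lambda>_. 1) = (\<lambda>_. 1)" for k
      by (induction k) (simp_all add: subdivision_one[OF sums])
    then show ?thesis
      by (simp add: subdivision_limit_def subdivision_interpolant_def pl_interpolant_def Let_def)
  qed
  moreover have "bounded (range (\<lambda>_ :: int. 1 :: real))"
    by simp
  ultimately show ?thesis
    unfolding convergent_subdivision_def by (metis zero_neq_one)
qed

section \<open>Schemes with a non-negative quotient symbol\<close>

theorem theorem3p6:
  fixes a q :: "int \<Rightarrow> real" and S_e S_o :: real
  assumes "finite {i. a i \<noteq> 0}"
    and "(\<Sum>\<^sub>\<infinity>j\<in>UNIV. a (2 * j)) = 1"
    and "(\<Sum>\<^sub>\<infinity>j\<in>UNIV. a (2 * j + 1)) = 1"
    and "q = fls_nth (quotient_symbol a)"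
    and "S_e = (\<Sum>\<^sub>\<infinity>j\<in>UNIV. q (2 * j))"
    and "S_o = (\<Sum>\<^sub>\<infinity>j\<in>UNIV. q (2 * j + 1))"
    and "\<And>i. q i \<ge> 0"
    and "max S_e S_o < 1"
  shows "convergent_subdivision a \<and> contractivity_factor a (max S_e S_o)"
proof -
  have aq: "a i = q i + q (i - 1)" for i
    unfolding assms(4) by (rule mask_eq_quotient_sum[OF assms(1)])
  \<comment> \<open>Two non-negative summands cannot cancel, so \<open>q\<close> inherits its finite support from \<open>a\<close>.\<close>
  have "{i. q i \<noteq> 0} \<subseteq> {i. a i \<noteq> 0}"
    using aq assms(7) by (auto simp: add_nonneg_eq_0_iff)
  then have fin: "finite {i. q i \<noteq> 0}"
    using assms(1) finite_subset by blast
  have "S_e + S_o = 1"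
    using quotient_parity_sums[OF fin aq assms(2)] assms(5,6) by simp
  then have pos: "0 < max S_e S_o"
    by linarith
  have contr: "\<bar>difference (subdivision a f) i\<bar> \<le> max S_e S_o * D"
    if "\<And>i. \<bar>difference f i\<bar> \<le> D" for f D i
    using difference_subdivision_le[of q a f D i, OF fin aq assms(7) that] assms(5,6) by simp
  show ?thesis
  proof
    show "convergent_subdivision a"
      by (rule convergent_subdivision_if_contractive[OF assms(1-3) less_imp_le[OF pos] assms(8)])
        (rule contr)
    show "contractivity_factor a (max S_e S_o)"
      by (rule contractivity_factorI[OF pos assms(8)]) (rule contr)
  qed
qed

end
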